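(* Let $m>0$ be an integer and let $u=u(n,t)$, with $u_j=u(n+j,t)$. Put $f=u_{-1}u_{-2}\cdots u_{-m}$, $f_j=T^j(f)$, and define the difference operators \[ P=uT^{m+1}+T,\qquad Q=T^m+u, \] \[ A=f(T^{-m}-T^m),\qquad B=f_1T^{-m}-f_mT^m+u(f_{m+1}-f). \] Then the lattice equation \[ u_{,t}=u^2(u_m\cdots u_1-u_{-1}\cdots u_{-m})-u(u_{m-1}\cdots u_1-u_{-1}\cdots u_{1-m}) \] (for $m=1$ the empty products $u_{m-1}\cdots u_1$ and $u_{-1}\cdots u_{1-m}$ both equal $1$) possesses the Lax representation \[ L_{,t}=[A,L],\qquad L=Q^{-1}P, \] written in the form of the system \[ P_{,t}=BP-PA,\qquad Q_{,t}=BQ-QA ; \] that is, this system of operator identities is equivalent to the lattice equation.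
   Context: Here $u=u(n,t)$ is a function of $n\in\mathbb Z$ and $t$ (equivalently, the $u_j$, $j\in\mathbb Z$, are treated as independent dynamical variables), $u_{,t}=\partial_t u$, $u_j=u(n+j,t)$, $u_0=u$. $T$ is the shift operator $T:u_j\mapsto u_{j+1}$. Difference operators are Laurent polynomials in $T$ whose coefficients are functions of finitely many of the $u_j$, multiplied by the rule $T\,a=T(a)\,T$; for a function $a$ write $a_j=T^j(a)$. The $t$-derivative of an operator is taken coefficientwise. $Q^{-1}$ is understood as a formal series in decreasing powers of $T$, and $[A,L]=AL-LA$. The lattice equation is the simplest member of the hierarchy denoted dSK$^{(1,m)}$, associated with the spectral problem $P\psi=\lambda Q\psi$. *)

theory Defs
  imports "HOL-Analysis.Analysis"
begin

section \<open>Formal series in decreasing powers of the shift operator\<close>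

text \<open>
  An element \<open>X\<close> stands for the formal series \<open>\<Sum>k. X\<^sub>k T\<^sup>k\<close>, where only finitely many of the powers
  with \<open>k > 0\<close> occur and the coefficients are functions of the lattice site;
  \<open>coef X k n\<close> is the value of \<open>X\<^sub>k\<close> at the site \<open>n\<close>.  Difference operators (Laurent polynomials
  in \<open>T\<close>) are the series with finitely many terms.
\<close>

typedef (overloaded) 'a shift_series =
  "{c :: int \<Rightarrow> int \<Rightarrow> 'a::zero. \<exists>N. \<forall>k>N. \<forall>n. c k n = 0}"
  morphisms coef Abs_shift_series
  by (rule exI[of _ "\<lambda>_ _. 0"]) auto

setup_lifting type_definition_shift_series

lemma shift_series_eqI: "(\<And>k n. coef X k n = coef Y k n) \<Longrightarrow> X = Y"
  by (metis coef_inject ext)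

definition deg_le :: "'a::zero shift_series \<Rightarrow> int \<Rightarrow> bool" where
  "deg_le X N \<longleftrightarrow> (\<forall>k>N. \<forall>n. coef X k n = 0)"

lemma deg_le_ex: "\<exists>N. deg_le X N"
  using coef[of X] by (auto simp: deg_le_def)

lemma deg_le_obtain:
  obtains N where "deg_le X N"
  using deg_le_ex by blast

text \<open>
  The product is determined by the rule \<open>T a = T(a) T\<close>, that is,
  \<open>(X Y)\<^sub>k(n) = \<Sum>i. X\<^sub>i(n) Y\<^sub>k\<^sub>-\<^sub>i(n + i)\<close>; this sum has finitely many nonzero terms.
\<close>

definition mult_coef :: "(int \<Rightarrow> int \<Rightarrow> 'a::ring_1) \<Rightarrow> (int \<Rightarrow> int \<Rightarrow> 'a) \<Rightarrow> int \<Rightarrow> int \<Rightarrow> 'a" where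
  "mult_coef X Y k n =
     (\<Sum>i | X i n * Y (k - i) (n + i) \<noteq> 0. X i n * Y (k - i) (n + i))"

lemma mult_coef_eq_sum:
  assumes X: "\<forall>k>M. \<forall>n. X k n = 0" and Y: "\<forall>k>N. \<forall>n. Y k n = 0"
    and I: "finite I" "{k - N..M} \<subseteq> I"
  shows "mult_coef X Y k n = (\<Sum>i\<in>I. X i n * Y (k - i) (n + i))"
proof -
  have "{i. X i n * Y (k - i) (n + i) \<noteq> 0} \<subseteq> {k - N..M}"
  proof
    fix i assume "i \<in> {i. X i n * Y (k - i) (n + i) \<noteq> 0}"
    then have "X i n \<noteq> 0" "Y (k - i) (n + i) \<noteq> 0" by auto
    with X Y have "i \<le> M" "k - i \<le> N" by (meson not_less)+
    then show "i \<in> {k - N..M}" by auto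
  qed
  then show ?thesis
    unfolding mult_coef_def using I by (intro sum.mono_neutral_left) auto
qed

lemma mult_coef_bounded:
  assumes X: "\<forall>k>M. \<forall>n. X k n = 0" and Y: "\<forall>k>N. \<forall>n. Y k n = 0"
  shows "\<forall>k>M + N. \<forall>n. mult_coef X Y k n = 0"
  using mult_coef_eq_sum[OF X Y, of "{}"] by auto

lemma bounded_binop:
  fixes X Y :: "int \<Rightarrow> int \<Rightarrow> 'a::zero"
  assumes "h 0 0 = (0::'a)" "\<exists>N. \<forall>k n. N < k \<longrightarrow> X k n = 0" "\<exists>N. \<forall>k n. N < k \<longrightarrow> Y k n = 0"
  shows "\<exists>N. \<forall>k n. N < k \<longrightarrow> h (X k n) (Y k n) = 0"
proof -
  obtain M N where "\<forall>k n. M < k \<longrightarrow> X k n = 0" "\<forall>k n. N < k \<longrightarrow> Y k n = 0"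
    using assms(2,3) by blast
  then show ?thesis
    by (intro exI[of _ "max M N"]) (auto simp: assms(1))
qed

instantiation shift_series :: (ring_1) ring_1
begin

lift_definition zero_shift_series :: "'a shift_series" is "\<lambda>_ _. 0"
  by auto

lift_definition one_shift_series :: "'a shift_series" is "\<lambda>k _. if k = 0 then 1 else 0"
  by (rule exI[of _ 0]) auto

lift_definition plus_shift_series :: "'a shift_series \<Rightarrow> 'a shift_series \<Rightarrow> 'a shift_series"
  is "\<lambda>X Y k n. X k n + Y k n"
  by (erule (1) bounded_binop[where h = "(+)", rotated]) simp

lift_definition uminus_shift_series :: "'a shift_series \<Rightarrow> 'a shift_series"
  is "\<lambda>X k n. - X k n"
  by auto

lift_definition minus_shift_series :: "'a shift_series \<Rightarrow> 'a shift_series \<Rightarrow> 'a shift_series"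
  is "\<lambda>X Y k n. X k n - Y k n"
  by (erule (1) bounded_binop[where h = "(-)", rotated]) simp

lift_definition times_shift_series :: "'a shift_series \<Rightarrow> 'a shift_series \<Rightarrow> 'a shift_series"
  is mult_coef
  using mult_coef_bounded by blast

lemma coef_times_eq_sum:
  fixes X Y :: "'a shift_series"
  assumes "deg_le X M" "deg_le Y N" "finite I" "{k - N..M} \<subseteq> I"
  shows "coef (X * Y) k n = (\<Sum>i\<in>I. coef X i n * coef Y (k - i) (n + i))"
  unfolding times_shift_series.rep_eq
  using assms by (intro mult_coef_eq_sum) (auto simp: deg_le_def)

lemma deg_le_times:
  fixes X Y :: "'a shift_series"
  assumes "deg_le X M" "deg_le Y N"
  shows "deg_le (X * Y) (M + N)"
  using assms mult_coef_bounded unfolding deg_le_def times_shift_series.rep_eq by blast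

lemma deg_le_mono: "deg_le (X :: 'b::zero shift_series) M \<Longrightarrow> M \<le> N \<Longrightarrow> deg_le X N"
  by (auto simp: deg_le_def)

lemma deg_le_plus:
  fixes X Y :: "'a shift_series"
  assumes "deg_le X M" "deg_le Y M"
  shows "deg_le (X + Y) M"
  using assms by (auto simp: deg_le_def plus_shift_series.rep_eq)

lemma shift_series_mult_assoc:
  fixes X Y Z :: "'a shift_series"
  shows "X * Y * Z = X * (Y * Z)"
proof (rule shift_series_eqI)
  fix k n
  obtain dX where X: "deg_le X dX" by (rule deg_le_obtain)
  obtain dY where Y: "deg_le Y dY" by (rule deg_le_obtain)
  obtain dZ where Z: "deg_le Z dZ" by (rule deg_le_obtain)
  define I where "I = {k - dY - dZ..dX}"
  define J where "J = {k - dZ..dX + dY}"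
  have "coef (X * Y * Z) k n = (\<Sum>j\<in>J. coef (X * Y) j n * coef Z (k - j) (n + j))"
    by (rule coef_times_eq_sum[OF deg_le_times[OF X Y] Z]) (auto simp: J_def)
  also have "\<dots> = (\<Sum>j\<in>J. (\<Sum>i\<in>I. coef X i n * coef Y (j - i) (n + i)) * coef Z (k - j) (n + j))"
  proof (rule sum.cong[OF refl])
    fix j assume "j \<in> J"
    then have "coef (X * Y) j n = (\<Sum>i\<in>I. coef X i n * coef Y (j - i) (n + i))"
      by (intro coef_times_eq_sum[OF X Y]) (auto simp: I_def J_def)
    then show "coef (X * Y) j n * coef Z (k - j) (n + j) =
      (\<Sum>i\<in>I. coef X i n * coef Y (j - i) (n + i)) * coef Z (k - j) (n + j)" by simp
  qed
  also have "\<dots> = (\<Sum>j\<in>J. \<Sum>i\<in>I. coef X i n * (coef Y (j - i) (n + i) * coef Z (k - j) (n + j)))"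
    by (simp add: sum_distrib_right mult.assoc)
  also have "\<dots> = (\<Sum>i\<in>I. \<Sum>j\<in>J. coef X i n * (coef Y (j - i) (n + i) * coef Z (k - j) (n + j)))"
    by (rule sum.swap)
  also have "\<dots> = (\<Sum>i\<in>I. coef X i n * (\<Sum>j\<in>J. coef Y (j - i) (n + i) * coef Z (k - j) (n + j)))"
    by (simp add: sum_distrib_left)
  also have "\<dots> = (\<Sum>i\<in>I. coef X i n * coef (Y * Z) (k - i) (n + i))"
  proof (rule sum.cong[OF refl])
    fix i assume i: "i \<in> I"
    have "coef (Y * Z) (k - i) (n + i) =
      (\<Sum>l\<in>(\<lambda>j. j - i) ` J. coef Y l (n + i) * coef Z (k - i - l) (n + i + l))"
    proof (rule coef_times_eq_sum[OF Y Z])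
      show "{k - i - dZ..dY} \<subseteq> (\<lambda>j. j - i) ` J"
      proof
        fix l assume "l \<in> {k - i - dZ..dY}"
        with i have "l + i \<in> J" by (auto simp: I_def J_def)
        then show "l \<in> (\<lambda>j. j - i) ` J" by (intro image_eqI[of _ _ "l + i"]) auto
      qed
    qed (simp add: J_def)
    also have "\<dots> = (\<Sum>j\<in>J. coef Y (j - i) (n + i) * coef Z (k - j) (n + j))"
      by (subst sum.reindex) (auto simp: inj_on_def)
    finally show "coef X i n * (\<Sum>j\<in>J. coef Y (j - i) (n + i) * coef Z (k - j) (n + j)) =
      coef X i n * coef (Y * Z) (k - i) (n + i)" by simp
  qed
  also have "\<dots> = coef (X * (Y * Z)) k n"
    by (rule coef_times_eq_sum[OF X deg_le_times[OF Y Z], symmetric]) (auto simp: I_def)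
  finally show "coef (X * Y * Z) k n = coef (X * (Y * Z)) k n" .
qed

instance
proof
  fix X Y Z :: "'a shift_series"
  show "X + Y + Z = X + (Y + Z)"
    by transfer (simp add: add.assoc)
  show "X + Y = Y + X"
    by transfer (simp add: add.commute)
  show "0 + X = X"
    by transfer simp
  show "- X + X = 0"
    by transfer simp
  show "X - Y = X + - Y"
    by transfer simp
  show "X * Y * Z = X * (Y * Z)"
    by (rule shift_series_mult_assoc)
  show "(X + Y) * Z = X * Z + Y * Z"
  proof (rule shift_series_eqI)
    fix k n
    obtain a b where "deg_le X a" "deg_le Y b" using deg_le_ex by metis
    then have XY: "deg_le X (max a b)" "deg_le Y (max a b)" by (auto intro: deg_le_mono)
    obtain c where Z: "deg_le Z c" by (rule deg_le_obtain)
    show "coef ((X + Y) * Z) k n = coef (X * Z + Y * Z) k n"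
      by (simp add: plus_shift_series.rep_eq sum.distrib distrib_right
          coef_times_eq_sum[OF deg_le_plus[OF XY] Z finite_atLeastAtMost_int order_refl]
          coef_times_eq_sum[OF XY(1) Z finite_atLeastAtMost_int order_refl]
          coef_times_eq_sum[OF XY(2) Z finite_atLeastAtMost_int order_refl])
  qed
  show "X * (Y + Z) = X * Y + X * Z"
  proof (rule shift_series_eqI)
    fix k n
    obtain a b where "deg_le Y a" "deg_le Z b" using deg_le_ex by metis
    then have YZ: "deg_le Y (max a b)" "deg_le Z (max a b)" by (auto intro: deg_le_mono)
    obtain c where X: "deg_le X c" by (rule deg_le_obtain)
    show "coef (X * (Y + Z)) k n = coef (X * Y + X * Z) k n"
      by (simp add: plus_shift_series.rep_eq sum.distrib distrib_left
          coef_times_eq_sum[OF X deg_le_plus[OF YZ] finite_atLeastAtMost_int order_refl]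
          coef_times_eq_sum[OF X YZ(1) finite_atLeastAtMost_int order_refl]
          coef_times_eq_sum[OF X YZ(2) finite_atLeastAtMost_int order_refl])
  qed
  show "1 * X = X"
  proof (rule shift_series_eqI)
    fix k n
    obtain c where X: "deg_le X c" by (rule deg_le_obtain)
    have 1: "deg_le (1 :: 'a shift_series) 0" by (auto simp: deg_le_def one_shift_series.rep_eq)
    have "coef (1 * X) k n =
        (\<Sum>i\<in>insert 0 {k - c..0}. coef 1 i n * coef X (k - i) (n + i))"
      by (rule coef_times_eq_sum[OF 1 X]) auto
    also have "\<dots> = (\<Sum>i\<in>{0}. coef 1 i n * coef X (k - i) (n + i))"
      by (rule sum.mono_neutral_right) (auto simp: one_shift_series.rep_eq)
    finally show "coef (1 * X) k n = coef X k n" by (simp add: one_shift_series.rep_eq)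
  qed
  show "X * 1 = X"
  proof (rule shift_series_eqI)
    fix k n
    obtain c where X: "deg_le X c" by (rule deg_le_obtain)
    have 1: "deg_le (1 :: 'a shift_series) 0" by (auto simp: deg_le_def one_shift_series.rep_eq)
    have "coef (X * 1) k n =
        (\<Sum>i\<in>insert k {k..c}. coef X i n * coef 1 (k - i) (n + i))"
      by (rule coef_times_eq_sum[OF X 1]) auto
    also have "\<dots> = (\<Sum>i\<in>{k}. coef X i n * coef 1 (k - i) (n + i))"
      by (rule sum.mono_neutral_right) (auto simp: one_shift_series.rep_eq)
    finally show "coef (X * 1) k n = coef X k n" by (simp add: one_shift_series.rep_eq)
  qed
  show "(0 :: 'a shift_series) \<noteq> 1"
  proof
    assume "(0 :: 'a shift_series) = 1"
    then have "coef (0 :: 'a shift_series) 0 0 = coef 1 0 0" by simp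
    then show False by (simp add: zero_shift_series.rep_eq one_shift_series.rep_eq)
  qed
qed

end

text \<open>\<open>fun_op a\<close> is multiplication by the function \<open>a\<close>, and \<open>Tpow j\<close> is the power \<open>T\<^sup>j\<close>.\<close>

lift_definition fun_op :: "(int \<Rightarrow> 'a::zero) \<Rightarrow> 'a shift_series" is
  "\<lambda>a k n. if k = 0 then a n else 0"
  by (rule exI[of _ 0]) auto

lift_definition Tpow :: "int \<Rightarrow> 'a::ring_1 shift_series" is
  "\<lambda>j k n. if k = j then 1 else 0"
  by (metis less_irrefl)

definition shift :: "int \<Rightarrow> (int \<Rightarrow> 'a) \<Rightarrow> int \<Rightarrow> 'a" where
  "shift j a = (\<lambda>n. a (n + j))"

lemma coef_fun_op_mult: "coef (fun_op a * X) k n = a n * coef X k n"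
  unfolding times_shift_series.rep_eq mult_coef_def fun_op.rep_eq
proof -
  have "(\<Sum>i | (if i = 0 then a n else 0) * coef X (k - i) (n + i) \<noteq> 0.
      (if i = 0 then a n else 0) * coef X (k - i) (n + i)) =
    (\<Sum>i\<in>{0}. (if i = 0 then a n else 0) * coef X (k - i) (n + i))"
    by (rule sum.mono_neutral_left) auto
  then show "(\<Sum>i | (if i = 0 then a n else 0) * coef X (k - i) (n + i) \<noteq> 0.
      (if i = 0 then a n else 0) * coef X (k - i) (n + i)) = a n * coef X k n"
    by simp
qed

lemma coef_Tpow_mult: "coef (Tpow j * X) k n = coef X (k - j) (n + j)"
  unfolding times_shift_series.rep_eq mult_coef_def Tpow.rep_eq
proof -
  have "(\<Sum>i | (if i = j then 1 else 0) * coef X (k - i) (n + i) \<noteq> 0.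
      (if i = j then 1 else 0) * coef X (k - i) (n + i)) =
    (\<Sum>i\<in>{j}. (if i = j then 1 else 0) * coef X (k - i) (n + i))"
    by (rule sum.mono_neutral_left) auto
  then show "(\<Sum>i | (if i = j then 1 else 0) * coef X (k - i) (n + i) \<noteq> 0.
      (if i = j then 1 else 0) * coef X (k - i) (n + i)) = coef X (k - j) (n + j)"
    by simp
qed

lemma coef_mult_fun_op: "coef (X * fun_op a) k n = coef X k n * a (n + k)"
  unfolding times_shift_series.rep_eq mult_coef_def fun_op.rep_eq
proof -
  have "(\<Sum>i | coef X i n * (if k - i = 0 then a (n + i) else 0) \<noteq> 0.
      coef X i n * (if k - i = 0 then a (n + i) else 0)) =
    (\<Sum>i\<in>{k}. coef X i n * (if k - i = 0 then a (n + i) else 0))"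
    by (rule sum.mono_neutral_left) auto
  then show "(\<Sum>i | coef X i n * (if k - i = 0 then a (n + i) else 0) \<noteq> 0.
      coef X i n * (if k - i = 0 then a (n + i) else 0)) = coef X k n * a (n + k)"
    by simp
qed

lemma coef_mult_Tpow: "coef (X * Tpow j) k n = coef X (k - j) n"
  unfolding times_shift_series.rep_eq mult_coef_def Tpow.rep_eq
proof -
  have "(\<Sum>i | coef X i n * (if k - i = j then 1 else 0) \<noteq> 0.
      coef X i n * (if k - i = j then 1 else 0)) =
    (\<Sum>i\<in>{k - j}. coef X i n * (if k - i = j then 1 else 0))"
    by (rule sum.mono_neutral_left) auto
  then show "(\<Sum>i | coef X i n * (if k - i = j then 1 else 0) \<noteq> 0.
      coef X i n * (if k - i = j then 1 else 0)) = coef X (k - j) n"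
    by simp
qed

lemma Tpow_mult_fun_op: "Tpow j * fun_op a = fun_op (shift j a) * Tpow j"
  by (rule shift_series_eqI)
    (auto simp: coef_fun_op_mult coef_Tpow_mult fun_op.rep_eq Tpow.rep_eq shift_def)

lemma Tpow_add: "Tpow (i + j) = Tpow i * Tpow j"
  by (rule shift_series_eqI) (auto simp: coef_Tpow_mult Tpow.rep_eq)

lemma Tpow_0: "Tpow 0 = 1"
  by (rule shift_series_eqI) (auto simp: Tpow.rep_eq one_shift_series.rep_eq)

text \<open>
  Used only for invertible \<open>X\<close>, in which case the two-sided inverse is unique; see
  \<open>op_inverse_unique\<close> and \<open>op_inverse_opQ\<close> below.
\<close>

definition op_inverse :: "'a::ring_1 shift_series \<Rightarrow> 'a shift_series" where
  "op_inverse X = (THE Y. X * Y = 1 \<and> Y * X = 1)"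

lemma op_inverse_unique:
  assumes "X * Y = 1" "Y * X = 1"
  shows "op_inverse X = Y"
  unfolding op_inverse_def
proof (rule the_equality)
  fix Z assume Z: "X * Z = 1 \<and> Z * X = 1"
  have "Z = Z * (X * Y)" using assms by simp
  also have "\<dots> = Y" using Z by (simp flip: mult.assoc)
  finally show "Z = Y" .
qed (use assms in simp)

text \<open>
  Coefficientwise derivative of a time-dependent series.  It is stated as a relation because the
  coefficientwise derivatives of an arbitrary family need not have bounded degree.
\<close>

definition has_op_derivative ::
    "(real \<Rightarrow> 'a::{real_normed_vector,ring_1} shift_series) \<Rightarrow> 'a shift_series \<Rightarrow> real \<Rightarrow> bool" where
  "has_op_derivative X D t \<longleftrightarrow>
     (\<forall>k n. ((\<lambda>s. coef (X s) k n) has_vector_derivative coef D k n) (at t))"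

section \<open>The operators and the lattice equation\<close>

text \<open>
  The argument \<open>v\<close> is the state of the lattice at a fixed time: \<open>v n = u(n,t)\<close>.  Thus
  \<open>v (n + j)\<close> is \<open>u\<^sub>j\<close>, evaluated at the site \<open>n\<close>.
\<close>

definition f_prod :: "nat \<Rightarrow> (int \<Rightarrow> 'a::comm_ring_1) \<Rightarrow> int \<Rightarrow> 'a" where
  "f_prod m v = (\<lambda>n. \<Prod>i=1..m. v (n - int i))"

definition opP :: "nat \<Rightarrow> (int \<Rightarrow> 'a::comm_ring_1) \<Rightarrow> 'a shift_series" where
  "opP m v = fun_op v * Tpow (int m + 1) + Tpow 1"

definition opQ :: "nat \<Rightarrow> (int \<Rightarrow> 'a::comm_ring_1) \<Rightarrow> 'a shift_series" where
  "opQ m v = Tpow (int m) + fun_op v"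

definition opA :: "nat \<Rightarrow> (int \<Rightarrow> 'a::comm_ring_1) \<Rightarrow> 'a shift_series" where
  "opA m v = fun_op (f_prod m v) * (Tpow (- int m) - Tpow (int m))"

definition opB :: "nat \<Rightarrow> (int \<Rightarrow> 'a::comm_ring_1) \<Rightarrow> 'a shift_series" where
  "opB m v =
     fun_op (shift 1 (f_prod m v)) * Tpow (- int m)
     - fun_op (shift (int m) (f_prod m v)) * Tpow (int m)
     + fun_op v * (fun_op (shift (int m + 1) (f_prod m v)) - fun_op (f_prod m v))"

definition opL :: "nat \<Rightarrow> (int \<Rightarrow> 'a::comm_ring_1) \<Rightarrow> 'a shift_series" where
  "opL m v = op_inverse (opQ m v) * opP m v"

definition lattice_rhs :: "nat \<Rightarrow> (int \<Rightarrow> 'a::comm_ring_1) \<Rightarrow> int \<Rightarrow> 'a" where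
  "lattice_rhs m v n =
     (v n)\<^sup>2 * ((\<Prod>i=1..m. v (n + int i)) - (\<Prod>i=1..m. v (n - int i)))
     - v n * ((\<Prod>i=1..m - 1. v (n + int i)) - (\<Prod>i=1..m - 1. v (n - int i)))"

lift_definition invQ :: "nat \<Rightarrow> (int \<Rightarrow> 'a::comm_ring_1) \<Rightarrow> 'a shift_series" is
  "\<lambda>m v k n. if k < 0 \<and> int m dvd k
     then (\<Prod>i=1..nat (- k div int m) - 1. - v (n - int i * int m)) else 0"
  by (rule exI[of _ 0]) auto

lemma coef_invQ:
  assumes "m > 0"
  shows "coef (invQ m v) (- (int m * int (Suc j))) n = (\<Prod>i=1..j. - v (n - int i * int m))"
proof -
  have "- int m < int m * int j"
    using assms by (smt (verit) mult_nonneg_nonneg of_nat_0_le_iff of_nat_0_less_iff)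
  moreover have "nat ((int m + int m * int j) div int m) = Suc j"
    using assms by (simp add: nat_eq_iff)
  ultimately show ?thesis
    using assms by (simp add: invQ.rep_eq algebra_simps)
qed

lemma coef_invQ_0:
  assumes "m > 0" and "\<And>j. k \<noteq> - (int m * int (Suc j))"
  shows "coef (invQ m v) k n = 0"
proof -
  have False if k: "k < 0" and d: "int m dvd k"
  proof -
    from d obtain q where q: "k = int m * q" by blast
    with k assms(1) have "q < 0" by (simp add: mult_less_0_iff)
    then have "q = - int (Suc (nat (- q - 1)))" by simp
    with q assms(2) show False by (metis mult_minus_right)
  qed
  then show ?thesis by (auto simp: invQ.rep_eq)
qed

lemma opQ_invQ:
  assumes m: "m > 0"
  shows "opQ m v * invQ m v = 1"
proof (rule shift_series_eqI)
  fix k n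
  have *: "coef (opQ m v * invQ m v) k n =
      coef (invQ m v) (k - int m) (n + int m) + v n * coef (invQ m v) k n"
    unfolding opQ_def by (simp add: distrib_right plus_shift_series.rep_eq coef_Tpow_mult coef_fun_op_mult)
  show "coef (opQ m v * invQ m v) k n = coef 1 k n"
  proof (cases "\<exists>j. k = - (int m * int j)")
    case False
    then have "k \<noteq> 0" by (metis mult_zero_right neg_equal_0_iff_equal of_nat_0)
    moreover have "coef (invQ m v) k n = 0"
      using False by (intro coef_invQ_0[OF m]) blast
    moreover have "coef (invQ m v) (k - int m) (n + int m) = 0"
    proof (rule coef_invQ_0[OF m])
      fix j show "k - int m \<noteq> - (int m * int (Suc j))"
      proof
        assume "k - int m = - (int m * int (Suc j))"
        then have "k = - (int m * int j)" by (simp add: algebra_simps)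
        with False show False by blast
      qed
    qed
    ultimately show ?thesis by (simp add: * one_shift_series.rep_eq)
  next
    case True
    then obtain j where k: "k = - (int m * int j)" by blast
    have k': "k - int m = - (int m * int (Suc j))" by (simp add: k algebra_simps)
    show ?thesis
    proof (cases j)
      case 0
      then have "coef (invQ m v) k n = 0"
        using m by (simp add: k invQ.rep_eq)
      moreover have "coef (invQ m v) (k - int m) (n + int m) = 1"
        unfolding k' coef_invQ[OF m] by (simp add: 0)
      ultimately show ?thesis unfolding * by (simp add: one_shift_series.rep_eq k 0)
    next
      case (Suc l)
      have "coef (invQ m v) (k - int m) (n + int m) =
          (\<Prod>i=1..Suc l. - v (n + int m - int i * int m))"
        unfolding k' coef_invQ[OF m] by (simp only: Suc)
      also have "\<dots> = - v n * (\<Prod>i=1..l. - v (n - int i * int m))"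
        by (subst prod.atLeast_Suc_atMost) (simp, simp only: prod.atLeast_Suc_atMost_Suc_shift,
            simp add: algebra_simps)
      finally show ?thesis
        using m unfolding * by (simp add: k Suc coef_invQ[OF m, of v l, unfolded of_nat_Suc] one_shift_series.rep_eq)
    qed
  qed
qed

lemma invQ_opQ:
  assumes m: "m > 0"
  shows "invQ m v * opQ m v = 1"
proof (rule shift_series_eqI)
  fix k n
  have *: "coef (invQ m v * opQ m v) k n =
      coef (invQ m v) (k - int m) n + coef (invQ m v) k n * v (n + k)"
    by (simp add: opQ_def distrib_left plus_shift_series.rep_eq coef_mult_Tpow coef_mult_fun_op)
  show "coef (invQ m v * opQ m v) k n = coef 1 k n"
  proof (cases "\<exists>j. k = - (int m * int j)")
    case False
    then have "k \<noteq> 0" by (metis mult_zero_right neg_equal_0_iff_equal of_nat_0)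
    moreover have "coef (invQ m v) k n = 0"
      using False by (intro coef_invQ_0[OF m]) blast
    moreover have "coef (invQ m v) (k - int m) n = 0"
    proof (rule coef_invQ_0[OF m])
      fix j show "k - int m \<noteq> - (int m * int (Suc j))"
      proof
        assume "k - int m = - (int m * int (Suc j))"
        then have "k = - (int m * int j)" by (simp add: algebra_simps)
        with False show False by blast
      qed
    qed
    ultimately show ?thesis by (simp add: * one_shift_series.rep_eq)
  next
    case True
    then obtain j where k: "k = - (int m * int j)" by blast
    have k': "k - int m = - (int m * int (Suc j))" by (simp add: k algebra_simps)
    show ?thesis
    proof (cases j)
      case 0
      then have "coef (invQ m v) k n = 0"
        using m by (simp add: k invQ.rep_eq)
      moreover have "coef (invQ m v) (k - int m) n = 1"
        unfolding k' coef_invQ[OF m] by (simp add: 0)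
      ultimately show ?thesis unfolding * by (simp add: one_shift_series.rep_eq k 0)
    next
      case (Suc l)
      have 1: "coef (invQ m v) (k - int m) n =
          (\<Prod>i=1..l. - v (n - int i * int m)) * - v (n + k)"
        unfolding k' coef_invQ[OF m] by (simp add: Suc k algebra_simps)
      have 2: "coef (invQ m v) k n = (\<Prod>i=1..l. - v (n - int i * int m))"
        unfolding k Suc by (rule coef_invQ[OF m])
      have "k \<noteq> 0" using m by (simp add: k Suc)
      then show ?thesis by (simp add: * 1 2 one_shift_series.rep_eq)
    qed
  qed
qed

lemma op_inverse_opQ:
  assumes "m > 0"
  shows "op_inverse (opQ m v) = invQ m v"
    and "opQ m v * op_inverse (opQ m v) = 1" and "op_inverse (opQ m v) * opQ m v = 1"
proof -
  show *: "op_inverse (opQ m v) = invQ m v"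
    by (rule op_inverse_unique[OF opQ_invQ[OF assms] invQ_opQ[OF assms]])
  show "opQ m v * op_inverse (opQ m v) = 1" "op_inverse (opQ m v) * opQ m v = 1"
    unfolding * by (rule opQ_invQ[OF assms] invQ_opQ[OF assms])+
qed

end

theory Submission
  imports Defs
begin

text \<open>
  For every state \<open>v\<close> the right-hand sides \<open>B P - P A\<close> and \<open>B Q - Q A\<close> collapse to \<open>r T\<^sup>m\<^sup>+\<^sup>1\<close> and \<open>r\<close>,
  with \<open>r\<close> the right-hand side of the lattice equation; this settles the equivalence with the system.
  Since \<open>Q L = P\<close>, the commutator \<open>D = [A, L]\<close> satisfies \<open>Q D + r L = r T\<^sup>m\<^sup>+\<^sup>1\<close>.  The coefficients of
  \<open>Q L = P\<close> at \<open>T\<^sup>k\<close> determine those of \<open>L\<close> recursively in decreasing order, so differentiating the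
  recursion gives \<open>L\<^sub>t = D\<close>.  Conversely, the leading coefficient of \<open>L\<close> is a shift of \<open>u\<close> and that of
  \<open>D\<close> the same shift of \<open>r\<close>.
\<close>

lemma f_prod_Suc:
  assumes "m > 0"
  shows "f_prod m v (n + 1) = v n * (\<Prod>i=1..m - 1. v (n - int i))"
proof -
  obtain l where m: "m = Suc l" using assms gr0_implies_Suc by blast
  show ?thesis
    unfolding f_prod_def m
    by (subst prod.atLeast_Suc_atMost) (simp, simp only: prod.atLeast_Suc_atMost_Suc_shift,
        simp add: algebra_simps)
qed

text \<open>Both sides are the product of \<open>v\<close> over the sites from \<open>n - m\<close>
  to \<open>n\<close>. This identity removes the unwanted powers of \<open>T\<close> in
  \<open>lax_P\<close> and \<open>lax_Q\<close>.\<close>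

lemma f_prod_exchange: "f_prod m v (n + 1) * v (n - int m) = v n * f_prod m v n"
proof (cases m)
  case (Suc l)
  then show ?thesis
    using f_prod_Suc[of m v n] by (simp add: f_prod_def mult.assoc)
qed (simp add: f_prod_def)

lemma f_prod_shift: "f_prod m v (n + int m + 1) = (\<Prod>i=1..m. v (n + int i))"
  unfolding f_prod_def
  by (rule prod.reindex_bij_witness[where i = "\<lambda>i. m + 1 - i" and j = "\<lambda>i. m + 1 - i"])
    (auto simp: of_nat_diff algebra_simps)

lemma f_prod_shift':
  assumes "m > 0"
  shows "f_prod m v (n + int m) = v n * (\<Prod>i=1..m - 1. v (n + int i))"
proof -
  obtain l where m: "m = Suc l" using assms gr0_implies_Suc by blast
  have "f_prod m v (n + int m) = (\<Prod>i=1..Suc l. v (n - 1 + int i))"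
    using f_prod_shift[of m v "n - 1"] by (simp add: m add_ac)
  also have "\<dots> = v n * (\<Prod>i=1..l. v (n + int i))"
    by (subst prod.atLeast_Suc_atMost) (simp, simp only: prod.atLeast_Suc_atMost_Suc_shift,
        simp add: algebra_simps)
  finally show ?thesis by (simp add: m)
qed

text \<open>The factor \<open>u\<close> in front of the shorter products completes them to
  \<open>f\<^sub>m\<close> and \<open>f\<^sub>1\<close>.\<close>

lemma lattice_rhs_f_prod:
  assumes "m > 0"
  shows "lattice_rhs m v n = (v n)\<^sup>2 * (f_prod m v (n + int m + 1) - f_prod m v n)
    - (f_prod m v (n + int m) - f_prod m v (n + 1))"
  unfolding lattice_rhs_def f_prod_shift f_prod_shift'[OF assms] f_prod_Suc[OF assms]
  by (simp add: f_prod_def algebra_simps)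

lemmas coef_simps = plus_shift_series.rep_eq minus_shift_series.rep_eq
  coef_fun_op_mult coef_Tpow_mult fun_op.rep_eq Tpow.rep_eq

lemma lax_P:
  assumes "m > 0"
  shows "opB m v * opP m v - opP m v * opA m v = fun_op (lattice_rhs m v) * Tpow (int m + 1)"
proof (rule shift_series_eqI)
  fix k n
  \<comment> \<open>Only these four powers occur in \<open>B P\<close> and \<open>P A\<close>.
    \<open>T^(1-m)\<close> cancels outright, \<open>T\<close> and \<open>T^(2m+1)\<close> by the
    exchange at \<open>n\<close> and at \<open>n + m\<close>.\<close>
  have "k = 1 \<or> k = 1 - int m \<or> k = 2 * int m + 1 \<or> k = int m + 1 \<or>
    (k \<noteq> 1 \<and> k \<noteq> 1 - int m \<and> k \<noteq> 2 * int m + 1 \<and> k \<noteq> int m + 1)" by blast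
  with assms show "coef (opB m v * opP m v - opP m v * opA m v) k n =
      coef (fun_op (lattice_rhs m v) * Tpow (int m + 1)) k n"
    using f_prod_exchange[of m v n] f_prod_exchange[of m v "n + int m"]
      lattice_rhs_f_prod[OF assms, of v n]
    unfolding opB_def opP_def opA_def
    by (elim disjE)
      (simp_all add: coef_simps distrib_left distrib_right left_diff_distrib right_diff_distrib
        mult.assoc shift_def power2_eq_square add_ac mult_ac)
qed

lemma lax_Q:
  assumes "m > 0"
  shows "opB m v * opQ m v - opQ m v * opA m v = fun_op (lattice_rhs m v)"
proof (rule shift_series_eqI)
  fix k n
  \<comment> \<open>Now the exchange at \<open>n\<close> and at \<open>n + m\<close> clears
    \<open>T^(-m)\<close> and \<open>T^m\<close>, while \<open>T^(2m)\<close> cancels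
    outright.\<close>
  have "k = 0 \<or> k = - int m \<or> k = int m \<or> k = 2 * int m \<or>
    (k \<noteq> 0 \<and> k \<noteq> - int m \<and> k \<noteq> int m \<and> k \<noteq> 2 * int m)" by blast
  with assms show "coef (opB m v * opQ m v - opQ m v * opA m v) k n =
      coef (fun_op (lattice_rhs m v)) k n"
    using f_prod_exchange[of m v n] f_prod_exchange[of m v "n + int m"]
      lattice_rhs_f_prod[OF assms, of v n]
    unfolding opB_def opQ_def opA_def
    by (elim disjE)
      (simp_all add: coef_simps distrib_left distrib_right left_diff_distrib right_diff_distrib
        mult.assoc shift_def power2_eq_square add_ac mult_ac)
qed

lemma opQ_opL:
  assumes "m > 0"
  shows "opQ m v * opL m v = opP m v"
  using op_inverse_opQ(2)[OF assms, of v] by (simp add: opL_def flip: mult.assoc)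

lemma coef_opQ_mult:
  "coef (opQ m v * X) k n = coef X (k - int m) (n + int m) + v n * coef X k n"
  by (simp add: opQ_def distrib_right coef_simps)

lemma coef_opP: "coef (opP m v) k n = (if k = int m + 1 then v n else 0) + (if k = 1 then 1 else 0)"
  by (simp add: opP_def coef_simps)

lemma coef_opQ: "coef (opQ m v) k n = (if k = int m then 1 else 0) + (if k = 0 then v n else 0)"
  by (simp add: opQ_def coef_simps)

text \<open>Comparing coefficients of \<open>T^k\<close> in \<open>Q L = P\<close> needs no
  division, because \<open>Q\<close> is monic.\<close>

lemma coef_opL_step:
  assumes "m > 0"
  shows "coef (opL m v) (k - int m) (n + int m) = coef (opP m v) k n - v n * coef (opL m v) k n"
  using coef_opQ_mult[of m v "opL m v" k n] by (simp add: opQ_opL[OF assms])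

lemma deg_le_opL:
  assumes "m > 0"
  shows "deg_le (opL m v) 1"
proof -
  have "deg_le (invQ m v) (- int m)"
    unfolding deg_le_def invQ.rep_eq
  proof (intro allI impI if_not_P notI)
    fix k :: int
    assume "- int m < k" "k < 0 \<and> int m dvd k"
    then show False using zdvd_imp_le[of "int m" "- k"] by simp
  qed
  moreover have "deg_le (opP m v) (int m + 1)"
    by (auto simp: deg_le_def coef_opP)
  ultimately show ?thesis
    using deg_le_times[of "invQ m v" "- int m" "opP m v" "int m + 1"]
    by (simp add: opL_def op_inverse_opQ(1)[OF assms])
qed

definition lax_comm :: "nat \<Rightarrow> (int \<Rightarrow> 'a::comm_ring_1) \<Rightarrow> 'a shift_series" where
  "lax_comm m v = opA m v * opL m v - opL m v * opA m v"

text \<open>By \<open>Q L = P\<close>, the term \<open>B P = B Q L\<close> can be added and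
  subtracted in \<open>Q [A, L] = Q A L - P A\<close>.\<close>

lemma opQ_lax_comm:
  assumes "m > 0"
  shows "opQ m v * lax_comm m v =
    fun_op (lattice_rhs m v) * Tpow (int m + 1) - fun_op (lattice_rhs m v) * opL m v"
proof -
  have "opQ m v * lax_comm m v = (opB m v * opP m v - opP m v * opA m v)
      - (opB m v * opQ m v - opQ m v * opA m v) * opL m v"
    by (simp add: lax_comm_def algebra_simps flip: opQ_opL[OF assms])
  then show ?thesis by (simp only: lax_P[OF assms] lax_Q[OF assms])
qed

text \<open>This is \<open>coef_opL_step\<close> differentiated by the product rule, with
  \<open>r\<close> in place of the derivative of \<open>u\<close>.\<close>

lemma coef_lax_comm_step:
  assumes "m > 0"
  shows "coef (lax_comm m v) (k - int m) (n + int m) =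
    (if k = int m + 1 then lattice_rhs m v n else 0)
    - (v n * coef (lax_comm m v) k n + lattice_rhs m v n * coef (opL m v) k n)"
  using coef_opQ_mult[of m v "lax_comm m v" k n]
  by (auto simp: opQ_lax_comm[OF assms] coef_simps algebra_simps)

lemma deg_le_lax_comm:
  assumes "m > 0"
  shows "deg_le (lax_comm m v) (int m + 1)"
proof -
  have "deg_le (opA m v) (int m)"
    by (auto simp: deg_le_def opA_def coef_simps)
  with deg_le_opL[OF assms, of v] show ?thesis
    using deg_le_times[of "opA m v" "int m" "opL m v" 1] deg_le_times[of "opL m v" 1 "opA m v" "int m"]
    by (simp add: lax_comm_def deg_le_def minus_shift_series.rep_eq add.commute[of 1])
qed

text \<open>\<open>L\<close> has no \<open>T^(m+1)\<close> term, so the \<open>T^(m+1)\<close>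
  coefficient of \<open>Q L = P\<close> isolates its \<open>T\<close> coefficient. This recovers
  \<open>u\<close> from \<open>L\<close>.\<close>

lemma coef_opL_1:
  assumes "m > 0"
  shows "coef (opL m v) 1 (n + int m) = v n"
  using coef_opL_step[OF assms, of v "int m + 1" n] deg_le_opL[OF assms, of v] assms
  by (simp add: coef_opP deg_le_def)

text \<open>
  The degree bound \<open>m + 1\<close> of the commutator is not attained: its top coefficient is read off at
  \<open>T\<^sup>2\<^sup>m\<^sup>+\<^sup>1\<close>, where nothing else contributes.
\<close>

lemma coef_lax_comm_1:
  assumes "m > 0"
  shows "coef (lax_comm m v) 1 (n + int m) = lattice_rhs m v n"
proof -
  have "coef (lax_comm m v) (int m + 1) n = 0"
    using coef_lax_comm_step[OF assms, of v "2 * int m + 1" "n - int m"]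
      deg_le_opL[OF assms, of v] deg_le_lax_comm[OF assms, of v] assms
    by (simp add: deg_le_def algebra_simps)
  then show ?thesis
    using coef_lax_comm_step[OF assms, of v "int m + 1" n] deg_le_opL[OF assms, of v] assms
    by (simp add: deg_le_def)
qed

lemma has_op_derivative_opL:
  fixes u :: "real \<Rightarrow> int \<Rightarrow> 'a::real_normed_field"
  assumes m: "m > 0"
    and u: "\<And>n. ((\<lambda>s. u s n) has_vector_derivative lattice_rhs m (u t) n) (at t)"
  shows "has_op_derivative (\<lambda>s. opL m (u s)) (lax_comm m (u t)) t"
proof -
  let ?R = "lattice_rhs m (u t)"
  have "((\<lambda>s. coef (opL m (u s)) k n) has_vector_derivative coef (lax_comm m (u t)) k n) (at t)"
    for k n
  \<comment> \<open>The recursion obtains power \<open>k\<close> from \<open>k + m\<close>, and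
    moving up to \<open>k + m\<close> lowers this measure while \<open>k \<le> m + 1\<close>. Beyond
    that both series vanish by their degree bounds.\<close>
  proof (induction "nat (int m + 2 - k)" arbitrary: k n rule: less_induct)
    case less
    show ?case
    proof (cases "k > int m + 1")
      case True
      with m have "coef (opL m (u s)) k n = 0" for s
        using deg_le_opL[OF m, of "u s"] by (simp add: deg_le_def)
      with True show ?thesis
        using deg_le_lax_comm[OF m, of "u t"] by (simp add: deg_le_def)
    next
      case False
      let ?k = "k + int m" and ?n = "n - int m"
      have IH: "((\<lambda>s. coef (opL m (u s)) ?k ?n) has_vector_derivative
          coef (lax_comm m (u t)) ?k ?n) (at t)"
        using False m by (intro less) auto
      have P: "((\<lambda>s. coef (opP m (u s)) ?k ?n) has_vector_derivative
          (if ?k = int m + 1 then ?R ?n else 0)) (at t)"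
        using u[of ?n] by (auto simp: coef_opP intro!: derivative_eq_intros)
      have "((\<lambda>s. coef (opP m (u s)) ?k ?n - u s ?n * coef (opL m (u s)) ?k ?n)
          has_vector_derivative
          (if ?k = int m + 1 then ?R ?n else 0)
          - (u t ?n * coef (lax_comm m (u t)) ?k ?n + ?R ?n * coef (opL m (u t)) ?k ?n)) (at t)"
        by (intro has_vector_derivative_diff P has_vector_derivative_mult u IH)
      moreover have "coef (opL m (u s)) k n =
          coef (opP m (u s)) ?k ?n - u s ?n * coef (opL m (u s)) ?k ?n" for s
        using coef_opL_step[OF m, of "u s" ?k ?n] by simp
      moreover have "coef (lax_comm m (u t)) k n = (if ?k = int m + 1 then ?R ?n else 0)
          - (u t ?n * coef (lax_comm m (u t)) ?k ?n + ?R ?n * coef (opL m (u t)) ?k ?n)"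
        using coef_lax_comm_step[OF m, of "u t" ?k ?n] by simp
      ultimately show ?thesis by (simp only:)
    qed
  qed
  then show ?thesis by (simp add: has_op_derivative_def)
qed

theorem theorem1:
  fixes m :: nat and S :: "real set" and u :: "real \<Rightarrow> int \<Rightarrow> 'a::real_normed_field"
  assumes "m > 0" and "open S"
  shows
    "((\<forall>t\<in>S. \<forall>n. ((\<lambda>s. u s n) has_vector_derivative lattice_rhs m (u t) n) (at t)) \<longleftrightarrow>
      (\<forall>t\<in>S.
        has_op_derivative (\<lambda>s. opP m (u s))
          (opB m (u t) * opP m (u t) - opP m (u t) * opA m (u t)) t \<and>
        has_op_derivative (\<lambda>s. opQ m (u s))
          (opB m (u t) * opQ m (u t) - opQ m (u t) * opA m (u t)) t)) \<and>
     ((\<forall>t\<in>S. \<forall>n. ((\<lambda>s. u s n) has_vector_derivative lattice_rhs m (u t) n) (at t)) \<longleftrightarrow>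
      (\<forall>t\<in>S.
        has_op_derivative (\<lambda>s. opL m (u s))
          (opA m (u t) * opL m (u t) - opL m (u t) * opA m (u t)) t))"
proof -
  let ?E = "\<lambda>t n. ((\<lambda>s. u s n) has_vector_derivative lattice_rhs m (u t) n) (at t)"
  \<comment> \<open>One implication suffices for \<open>P\<close>, since \<open>Q\<close> alone
    already gives back the lattice equation.\<close>
  have P: "has_op_derivative (\<lambda>s. opP m (u s)) (fun_op (lattice_rhs m (u t)) * Tpow (int m + 1)) t"
    if "\<And>n. ?E t n" for t
    unfolding has_op_derivative_def
    using that by (auto simp: coef_opP coef_simps intro!: derivative_eq_intros)
  have Q: "has_op_derivative (\<lambda>s. opQ m (u s)) (fun_op (lattice_rhs m (u t))) t \<longleftrightarrow> (\<forall>n. ?E t n)"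
    for t
  proof
    assume "has_op_derivative (\<lambda>s. opQ m (u s)) (fun_op (lattice_rhs m (u t))) t"
    then have "((\<lambda>s. coef (opQ m (u s)) 0 n) has_vector_derivative
        coef (fun_op (lattice_rhs m (u t))) 0 n) (at t)" for n
      by (simp add: has_op_derivative_def)
    \<comment> \<open>As \<open>m > 0\<close>, the term \<open>T^m\<close> does not contribute to
      the \<open>T^0\<close> coefficient of \<open>Q\<close>, which is therefore
      \<open>u\<close>.\<close>
    then show "\<forall>n. ?E t n"
      using assms(1) by (simp add: coef_opQ fun_op.rep_eq)
  next
    assume "\<forall>n. ?E t n"
    then show "has_op_derivative (\<lambda>s. opQ m (u s)) (fun_op (lattice_rhs m (u t))) t"
      unfolding has_op_derivative_def
      by (auto simp: coef_opQ fun_op.rep_eq intro!: derivative_eq_intros)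
  qed
  have L: "has_op_derivative (\<lambda>s. opL m (u s)) (lax_comm m (u t)) t \<longleftrightarrow> (\<forall>n. ?E t n)" for t
  proof
    assume "has_op_derivative (\<lambda>s. opL m (u s)) (lax_comm m (u t)) t"
    then have "((\<lambda>s. coef (opL m (u s)) 1 (n + int m)) has_vector_derivative
        coef (lax_comm m (u t)) 1 (n + int m)) (at t)" for n
      by (simp add: has_op_derivative_def)
    then show "\<forall>n. ?E t n"
      by (simp add: coef_opL_1[OF assms(1)] coef_lax_comm_1[OF assms(1)])
  qed (use has_op_derivative_opL[OF assms(1)] in blast)
  show ?thesis
    unfolding lax_P[OF assms(1)] lax_Q[OF assms(1)] lax_comm_def[symmetric] L Q
    using P by blast
qed

end
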